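(* For all $n \in \mathbb{N}$, the free group $F_n$ of rank $n$ admits an invariant midpointed convex geometry.
   Context: Let $G$ be a group and $\mathrm{FinSet}(G)$ the set of finite subsets of $G$. A family $\mathcal{C} \subset \mathrm{FinSet}(G)$ is a convex geometry if $\mathcal{C} = \{\tau(B) : B \in \mathrm{FinSet}(G)\}$ for a map $\tau : \mathrm{FinSet}(G) \to \mathrm{FinSet}(G)$ with $\tau(\emptyset) = \emptyset$, $B \subset \tau(B)$, $B \subset B' \implies \tau(B) \subset \tau(B')$, $\tau(\tau(B)) = \tau(B)$, and such that the anti-exchange axiom holds: if $C \in \mathcal{C}$, $y \neq z$, $C \cap \{y,z\} = \emptyset$ and $y \in \tau(C \cup \{z\})$, then $z \notin \tau(C \cup \{y\})$. It is invariant if $C \in \mathcal{C}$ implies $gC \in \mathcal{C}$ for all $g \in G$, and midpointed if $g \in \tau(\{gh, gh^{-1}\})$ for all $g, h \in G$. *)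

theory Defs
  imports "HOL-Algebra.Coset"
begin

(* The free group of rank n is the group of reduced words in the generators 0, ..., n - 1.
   The letter (True, i) stands for the generator i and (False, i) for its formal inverse. *)

type_synonym letter = "bool \<times> nat"

definition inv_letter :: "letter \<Rightarrow> letter" where
  "inv_letter x = (\<not> fst x, snd x)"

definition reduced :: "letter list \<Rightarrow> bool" where
  "reduced w \<longleftrightarrow> successively (\<lambda>x y. y \<noteq> inv_letter x) w"

fun push :: "letter \<Rightarrow> letter list \<Rightarrow> letter list" where
  "push x [] = [x]"
| "push x (y # w) = (if y = inv_letter x then w else x # y # w)"

(* For reduced u and v, foldr push u v is the reduced form of the concatenation u @ v. *)
definition free_group :: "nat \<Rightarrow> letter list monoid" where
  "free_group n =
     \<lparr>carrier = {w. set w \<subseteq> UNIV \<times> {..<n} \<and> reduced w},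
      mult = (\<lambda>u v. foldr push u v),
      one = []\<rparr>"

lemma inv_letter_inv_letter [simp]: "inv_letter (inv_letter x) = x"
  by (simp add: inv_letter_def)

lemma snd_inv_letter [simp]: "snd (inv_letter x) = snd x"
  by (simp add: inv_letter_def)

lemma reduced_Nil [simp]: "reduced []"
  by (simp add: reduced_def)

lemma reduced_Cons:
  "reduced (x # w) \<longleftrightarrow> reduced w \<and> (w = [] \<or> hd w \<noteq> inv_letter x)"
  by (cases w) (auto simp: reduced_def)

lemma reduced_push: "reduced w \<Longrightarrow> reduced (push x w)"
  by (cases w) (auto simp: reduced_Cons)

lemma set_push: "set (push x w) \<subseteq> insert x (set w)"
  by (cases w) auto

lemma push_reduced_Cons: "reduced (x # w) \<Longrightarrow> push x w = x # w"
  by (cases w) (auto simp: reduced_Cons)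

lemma push_inv_push: "reduced w \<Longrightarrow> push (inv_letter x) (push x w) = w"
  by (cases w) (auto simp: push_reduced_Cons reduced_Cons)

lemma push_push_inv: "reduced w \<Longrightarrow> push x (push (inv_letter x) w) = w"
  using push_inv_push[of w "inv_letter x"] by simp

lemma reduced_foldr_push: "reduced v \<Longrightarrow> reduced (foldr push u v)"
  by (induction u) (auto intro: reduced_push)

lemma set_foldr_push: "set (foldr push u v) \<subseteq> set u \<union> set v"
proof (induction u)
  case (Cons a u)
  then show ?case using set_push[of a "foldr push u v"] by auto
qed simp

lemma foldr_push_Nil: "reduced u \<Longrightarrow> foldr push u [] = u"
  by (induction u) (auto simp: push_reduced_Cons, auto simp: reduced_Cons push_reduced_Cons)

lemma foldr_push_push:
  assumes "reduced v"
  shows "foldr push (push x u) v = push x (foldr push u v)"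
proof (cases u)
  case (Cons y w)
  then show ?thesis
    using push_push_inv[OF reduced_foldr_push[OF assms], of x w] by simp
qed simp

lemma foldr_push_assoc:
  assumes "reduced w"
  shows "foldr push (foldr push u v) w = foldr push u (foldr push v w)"
  by (induction u) (simp_all add: foldr_push_push[OF assms])

lemma foldr_push_inverse:
  "reduced w \<Longrightarrow> foldr push (rev (map inv_letter u)) (foldr push u w) = w"
  by (induction u) (simp_all add: push_inv_push reduced_foldr_push)

lemma reduced_rev_inv: "reduced w \<Longrightarrow> reduced (rev (map inv_letter w))"
  unfolding reduced_def successively_rev successively_map
  by (erule successively_mono) (metis inv_letter_inv_letter)

theorem group_free_group: "group (free_group n)"
proof (rule groupI, goal_cases)
  case (1 x y)
  then show ?case
    using set_foldr_push[of x y] by (auto simp: free_group_def reduced_foldr_push)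
next
  case (5 x)
  then have x: "set x \<subseteq> UNIV \<times> {..<n}" "reduced x" by (auto simp: free_group_def)
  have "rev (map inv_letter x) \<in> carrier (free_group n)"
    using x by (force simp: free_group_def reduced_rev_inv inv_letter_def)
  moreover have "rev (map inv_letter x) \<otimes>\<^bsub>free_group n\<^esub> x = \<one>\<^bsub>free_group n\<^esub>"
    using foldr_push_inverse[of "[]" x] x by (simp add: free_group_def foldr_push_Nil)
  ultimately show ?case by blast
qed (auto simp: free_group_def foldr_push_assoc)

definition free_gen :: "nat \<Rightarrow> letter list" where
  "free_gen i = [(True, i)]"

(* The universal property of the free group on the generators free_gen i, i < n. *)

definition letter_val :: "('a, 'b) monoid_scheme \<Rightarrow> (nat \<Rightarrow> 'a) \<Rightarrow> letter \<Rightarrow> 'a" where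
  "letter_val H f x = (if fst x then f (snd x) else inv\<^bsub>H\<^esub> (f (snd x)))"

definition word_val :: "('a, 'b) monoid_scheme \<Rightarrow> (nat \<Rightarrow> 'a) \<Rightarrow> letter list \<Rightarrow> 'a" where
  "word_val H f w = foldr (\<lambda>x a. letter_val H f x \<otimes>\<^bsub>H\<^esub> a) w \<one>\<^bsub>H\<^esub>"

theorem free_group_extension:
  assumes "group H" and f: "\<And>i. i < n \<Longrightarrow> f i \<in> carrier H"
  shows "\<exists>\<phi> \<in> hom (free_group n) H. \<forall>i<n. \<phi> (free_gen i) = f i"
proof -
  interpret H: group H by fact
  let ?L = "UNIV \<times> {..<n} :: letter set"
  have val: "letter_val H f x \<in> carrier H" if "x \<in> ?L" for x
    using that f by (auto simp: letter_val_def)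
  have wval: "word_val H f w \<in> carrier H" if "set w \<subseteq> ?L" for w
    using that by (induction w) (auto simp: word_val_def val)
  have inv: "letter_val H f (inv_letter x) = inv\<^bsub>H\<^esub> (letter_val H f x)" if "x \<in> ?L" for x
    using that f by (auto simp: letter_val_def inv_letter_def)
  have push: "word_val H f (push x w) = letter_val H f x \<otimes>\<^bsub>H\<^esub> word_val H f w"
    if "x \<in> ?L" "set w \<subseteq> ?L" for x w
  proof (cases w)
    case (Cons y v)
    then show ?thesis
      using that val[of x] wval[of v] inv[of x]
      by (auto simp: word_val_def H.m_assoc[symmetric])
  qed (simp add: word_val_def)
  have mult: "word_val H f (foldr push u w) = word_val H f u \<otimes>\<^bsub>H\<^esub> word_val H f w"
    if "set u \<subseteq> ?L" "set w \<subseteq> ?L" for u w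
    using that(1)
  proof (induction u)
    case Nil
    then show ?case using wval[OF that(2)] by (simp add: word_val_def)
  next
    case (Cons x u)
    have "set (foldr push u w) \<subseteq> ?L"
      using set_foldr_push[of u w] Cons.prems that(2) by auto
    moreover have "word_val H f (x # u) = letter_val H f x \<otimes>\<^bsub>H\<^esub> word_val H f u"
      by (simp add: word_val_def)
    ultimately show ?case
      using Cons val[of x] wval[of u] wval[OF that(2)] push[of x "foldr push u w"]
      by (simp add: H.m_assoc)
  qed
  have "word_val H f \<in> hom (free_group n) H"
    by (rule homI) (auto simp: free_group_def mult wval)
  moreover have "\<forall>i<n. word_val H f (free_gen i) = f i"
    using f by (simp add: word_val_def free_gen_def letter_val_def)
  ultimately show ?thesis by blast
qed

theorem free_group_hom_unique:
  assumes "group H" and \<phi>: "\<phi> \<in> hom (free_group n) H" and \<psi>: "\<psi> \<in> hom (free_group n) H"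
    and eq: "\<And>i. i < n \<Longrightarrow> \<phi> (free_gen i) = \<psi> (free_gen i)"
    and w: "w \<in> carrier (free_group n)"
  shows "\<phi> w = \<psi> w"
proof -
  interpret F: group "free_group n" by (rule group_free_group)
  interpret p: group_hom "free_group n" H \<phi>
    using assms(1) \<phi> by (simp add: group_hom_def group_hom_axioms_def F.is_group)
  interpret q: group_hom "free_group n" H \<psi>
    using assms(1) \<psi> by (simp add: group_hom_def group_hom_axioms_def F.is_group)
  have gen: "free_gen i \<in> carrier (free_group n)" if "i < n" for i
    using that by (simp add: free_gen_def free_group_def reduced_def)
  have letter: "[x] \<in> carrier (free_group n)" "\<phi> [x] = \<psi> [x]" if "x \<in> UNIV \<times> {..<n}" for x
  proof -
    obtain b i where x: "x = (b, i)" "i < n" using \<open>x \<in> UNIV \<times> {..<n}\<close> by auto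
    show mem: "[x] \<in> carrier (free_group n)"
      using x by (simp add: free_group_def reduced_def)
    show "\<phi> [x] = \<psi> [x]"
    proof (cases b)
      case True
      then show ?thesis using x eq by (simp add: free_gen_def)
    next
      case False
      have "[x] \<otimes>\<^bsub>free_group n\<^esub> free_gen i = \<one>\<^bsub>free_group n\<^esub>"
        using x False by (simp add: free_group_def free_gen_def inv_letter_def)
      then have "[x] = inv\<^bsub>free_group n\<^esub> (free_gen i)"
        using mem gen[OF x(2)] by (simp add: F.inv_equality)
      then show ?thesis using gen[OF x(2)] eq[OF x(2)] by simp
    qed
  qed
  show ?thesis using w
  proof (induction w)
    case Nil
    then show ?case using p.hom_one q.hom_one by (simp add: free_group_def)
  next
    case (Cons x w)
    then have w: "w \<in> carrier (free_group n)" and x: "x \<in> UNIV \<times> {..<n}"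
      and r: "reduced (x # w)"
      by (auto simp: free_group_def reduced_Cons)
    have "x # w = [x] \<otimes>\<^bsub>free_group n\<^esub> w"
      using push_reduced_Cons[OF r] by (simp add: free_group_def)
    then show ?case
      using Cons.IH[OF w] letter[OF x] w by simp
  qed
qed

definition convex_geometry ::
    "('a, 'b) monoid_scheme \<Rightarrow> 'a set set \<Rightarrow> ('a set \<Rightarrow> 'a set) \<Rightarrow> bool" where
  "convex_geometry G \<C> \<tau> \<longleftrightarrow>
     (\<forall>B \<in> Fpow (carrier G). \<tau> B \<in> Fpow (carrier G)) \<and>
     \<C> = \<tau> ` Fpow (carrier G) \<and>
     \<tau> {} = {} \<and>
     (\<forall>B \<in> Fpow (carrier G). B \<subseteq> \<tau> B) \<and>
     (\<forall>B \<in> Fpow (carrier G). \<forall>B' \<in> Fpow (carrier G). B \<subseteq> B' \<longrightarrow> \<tau> B \<subseteq> \<tau> B') \<and>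
     (\<forall>B \<in> Fpow (carrier G). \<tau> (\<tau> B) = \<tau> B) \<and>
     (\<forall>C \<in> \<C>. \<forall>y \<in> carrier G. \<forall>z \<in> carrier G.
        y \<noteq> z \<and> C \<inter> {y, z} = {} \<and> y \<in> \<tau> (C \<union> {z}) \<longrightarrow> z \<notin> \<tau> (C \<union> {y}))"

definition invariant :: "('a, 'b) monoid_scheme \<Rightarrow> 'a set set \<Rightarrow> bool" where
  "invariant G \<C> \<longleftrightarrow> (\<forall>C \<in> \<C>. \<forall>g \<in> carrier G. g <#\<^bsub>G\<^esub> C \<in> \<C>)"

definition midpointed :: "('a, 'b) monoid_scheme \<Rightarrow> ('a set \<Rightarrow> 'a set) \<Rightarrow> bool" where
  "midpointed G \<tau> \<longleftrightarrow>
     (\<forall>g \<in> carrier G. \<forall>h \<in> carrier G. g \<in> \<tau> {g \<otimes>\<^bsub>G\<^esub> h, g \<otimes>\<^bsub>G\<^esub> inv\<^bsub>G\<^esub> h})"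

(* The map \<tau> is determined by the family \<C>, so being midpointed is a property of \<C>. *)
lemma convex_geometry_map_unique:
  assumes "convex_geometry G \<C> \<tau>" "convex_geometry G \<C> \<tau>'" "B \<in> Fpow (carrier G)"
  shows "\<tau> B = \<tau>' B"
proof -
  have "\<sigma> B \<subseteq> \<rho> B" if \<sigma>: "convex_geometry G \<C> \<sigma>" and \<rho>: "convex_geometry G \<C> \<rho>" for \<sigma> \<rho>
  proof -
    have "\<rho> B \<in> \<C>" "B \<subseteq> \<rho> B" and fin: "\<rho> B \<in> Fpow (carrier G)"
      using \<rho> assms(3) unfolding convex_geometry_def by auto
    then obtain D where "D \<in> Fpow (carrier G)" "\<rho> B = \<sigma> D"
      using \<sigma> unfolding convex_geometry_def by auto
    then have "\<sigma> (\<rho> B) = \<rho> B"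
      using \<sigma> unfolding convex_geometry_def by simp
    moreover have "\<sigma> B \<subseteq> \<sigma> (\<rho> B)"
      using \<sigma> assms(3) fin \<open>B \<subseteq> \<rho> B\<close> unfolding convex_geometry_def by blast
    ultimately show ?thesis by simp
  qed
  then show ?thesis using assms(1,2) by blast
qed

end

theory Submission
  imports Defs "HOL-Library.List_Lenlexorder" "HOL-Library.Product_Lexorder"
begin

text \<open>
  Every nonempty family of total orders on a set yields a closure operator: the hull of \<open>B\<close> consists of the points
  that no order in the family ranks strictly above all of \<open>B\<close>. Such a closure always has the
  anti-exchange property. If \<open>y\<close> lies outside a closed set \<open>C\<close>, some order ranks \<open>y\<close> above all of \<open>C\<close>;
  if moreover \<open>y\<close> is in the hull of \<open>C \<union> {z}\<close> and \<open>z\<close> in the hull of \<open>C \<union> {y}\<close>, that one order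
  gives \<open>y \<le> z\<close> and then \<open>z \<le> y\<close>.

  On a group, the family of all left translates of a single total order gives an invariant closure.
  Hulls of finite sets are finite as soon as the order has finite initial segments, and the closure is
  midpointed as soon as no \<open>g\<close> exceeds both \<open>g h\<close> and \<open>g h\<inverse>\<close>.

  In the free group the shortlex order has both properties, because for \<open>h \<noteq> 1\<close> one of
  \<open>g h\<close> and \<open>g h\<inverse>\<close> is strictly longer than \<open>g\<close> (\<open>length_less_max_mult\<close>).
  Otherwise at least half of \<open>h\<close> would cancel in \<open>g h\<close> and at least half of \<open>h\<inverse>\<close> in \<open>g h\<inverse>\<close>. Then \<open>g\<close>
  would end both with the inverse of the first half of \<open>h\<close> and with the second half of \<open>h\<close>,
  so these two words would coincide and \<open>h\<close> would be equal to its own inverse.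
\<close>

section \<open>The closure generated by the left translates of a total order\<close>

text \<open>
  The total order on the group is pulled back along an injective map \<open>\<rho>\<close> to a linear order;
  \<open>\<rho> (p \<otimes> x)\<close>, as a function of \<open>x\<close>, represents its translate by \<open>p\<close>.
\<close>

locale ranked_group = group G for G (structure) +
  fixes \<rho> :: "'a \<Rightarrow> 'b::linorder"
  assumes inj_rank: "inj_on \<rho> (carrier G)"
    and finite_below: "b \<in> carrier G \<Longrightarrow> finite {x \<in> carrier G. \<rho> x \<le> \<rho> b}"
    and rank_midpoint: "\<lbrakk>g \<in> carrier G; h \<in> carrier G\<rbrakk>
      \<Longrightarrow> \<rho> g \<le> max (\<rho> (g \<otimes> h)) (\<rho> (g \<otimes> inv h))"
begin

definition hull :: "'a set \<Rightarrow> 'a set" where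
  "hull B = {x \<in> carrier G. \<forall>p \<in> carrier G. \<exists>b \<in> B. \<rho> (p \<otimes> x) \<le> \<rho> (p \<otimes> b)}"

lemma hull_mono: "B \<subseteq> B' \<Longrightarrow> hull B \<subseteq> hull B'"
  unfolding hull_def by blast

lemma hull_extensive: "B \<subseteq> carrier G \<Longrightarrow> B \<subseteq> hull B"
  unfolding hull_def by blast

lemma hull_empty: "hull {} = {}"
  unfolding hull_def by auto

lemma hull_idem:
  assumes "B \<subseteq> carrier G"
  shows "hull (hull B) = hull B"
proof
  show "hull (hull B) \<subseteq> hull B"
  proof
    fix x assume x: "x \<in> hull (hull B)"
    have "\<exists>b \<in> B. \<rho> (p \<otimes> x) \<le> \<rho> (p \<otimes> b)" if p: "p \<in> carrier G" for p
    proof -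
      obtain c where c: "c \<in> hull B" "\<rho> (p \<otimes> x) \<le> \<rho> (p \<otimes> c)"
        using x p unfolding hull_def[of "hull B"] by blast
      then obtain b where "b \<in> B" "\<rho> (p \<otimes> c) \<le> \<rho> (p \<otimes> b)"
        using p unfolding hull_def by blast
      with c show ?thesis using order_trans by blast
    qed
    then show "x \<in> hull B" using x by (simp add: hull_def)
  qed
  show "hull B \<subseteq> hull (hull B)"
    by (rule hull_extensive) (auto simp: hull_def)
qed

text \<open>The untranslated order alone already bounds the hull.\<close>

lemma hull_in_Fpow:
  assumes "B \<in> Fpow (carrier G)"
  shows "hull B \<in> Fpow (carrier G)"
proof -
  have "hull B \<subseteq> (\<Union>b\<in>B. {x \<in> carrier G. \<rho> x \<le> \<rho> b})"
  proof
    fix x assume "x \<in> hull B"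
    then obtain b where b: "b \<in> B" "\<rho> (\<one> \<otimes> x) \<le> \<rho> (\<one> \<otimes> b)" "x \<in> carrier G"
      unfolding hull_def using one_closed by blast
    moreover have "b \<in> carrier G" using assms b(1) by (auto simp: Fpow_def)
    ultimately show "x \<in> (\<Union>b\<in>B. {x \<in> carrier G. \<rho> x \<le> \<rho> b})"
      by auto
  qed
  moreover have "finite (\<Union>b\<in>B. {x \<in> carrier G. \<rho> x \<le> \<rho> b})"
    using assms finite_below by (auto simp: Fpow_def)
  ultimately have "finite (hull B)"
    by (rule finite_subset)
  then show ?thesis by (auto simp: Fpow_def hull_def)
qed

text \<open>
  The translate that separates \<open>y\<close> from \<open>C\<close> compares \<open>y\<close> and \<open>z\<close> in both directions.
\<close>

lemma hull_anti_exchange: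
  assumes C: "hull C = C" and y: "y \<in> carrier G" "y \<notin> C" and z: "z \<in> carrier G"
    and yz: "y \<in> hull (C \<union> {z})" and zy: "z \<in> hull (C \<union> {y})"
  shows "y = z"
proof -
  have "y \<notin> hull C" using C y by simp
  then obtain p where p: "p \<in> carrier G" and above: "\<And>c. c \<in> C \<Longrightarrow> \<rho> (p \<otimes> c) < \<rho> (p \<otimes> y)"
    using y unfolding hull_def by (auto simp: not_le)
  have "\<exists>b \<in> C \<union> {z}. \<rho> (p \<otimes> y) \<le> \<rho> (p \<otimes> b)"
    using yz p unfolding hull_def by blast
  then have 1: "\<rho> (p \<otimes> y) \<le> \<rho> (p \<otimes> z)"
    using above leD by blast
  have "\<exists>b \<in> C \<union> {y}. \<rho> (p \<otimes> z) \<le> \<rho> (p \<otimes> b)"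
    using zy p unfolding hull_def by blast
  then have "\<rho> (p \<otimes> z) \<le> \<rho> (p \<otimes> y)"
    using above by (metis UnE less_imp_le order_trans singletonD)
  with 1 have "\<rho> (p \<otimes> y) = \<rho> (p \<otimes> z)" by simp
  then have "p \<otimes> y = p \<otimes> z"
    using inj_rank p y z by (auto dest: inj_onD)
  then show ?thesis using p y z by simp
qed

lemma convex_geometry_hull: "convex_geometry G (hull ` Fpow (carrier G)) hull"
proof -
  have closed: "hull C = C" if "C \<in> hull ` Fpow (carrier G)" for C
    using that hull_idem by (auto simp: Fpow_def)
  show ?thesis
    unfolding convex_geometry_def
  proof (intro conjI ballI impI notI)
    fix C y z
    assume C: "C \<in> hull ` Fpow (carrier G)" and yG: "y \<in> carrier G" and zG: "z \<in> carrier G"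
      and H: "y \<noteq> z \<and> C \<inter> {y, z} = {} \<and> y \<in> hull (C \<union> {z})" and zy: "z \<in> hull (C \<union> {y})"
    show False
      using hull_anti_exchange[OF closed[OF C] yG _ zG _ zy] H by blast
  next
    fix B assume "B \<in> Fpow (carrier G)"
    then have B: "B \<subseteq> carrier G" by (simp add: Fpow_def)
    show "B \<subseteq> hull B" "hull (hull B) = hull B"
      by (rule hull_extensive[OF B], rule hull_idem[OF B])
  qed (simp_all add: hull_empty hull_in_Fpow hull_mono)
qed

lemma l_coset_hull_subset:
  assumes g: "g \<in> carrier G" and B: "B \<subseteq> carrier G"
  shows "g <# hull B \<subseteq> hull (g <# B)"
proof
  fix y assume "y \<in> g <# hull B"
  then obtain x where x: "x \<in> hull B" and y: "y = g \<otimes> x"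
    by (auto simp: l_coset_def)
  have xG: "x \<in> carrier G" using x by (simp add: hull_def)
  have "\<exists>c \<in> g <# B. \<rho> (p \<otimes> y) \<le> \<rho> (p \<otimes> c)" if p: "p \<in> carrier G" for p
  proof -
    have "p \<otimes> g \<in> carrier G" using p g by simp
    then obtain b where b: "b \<in> B" "\<rho> (p \<otimes> g \<otimes> x) \<le> \<rho> (p \<otimes> g \<otimes> b)"
      using x unfolding hull_def by blast
    moreover have "b \<in> carrier G" using b B by blast
    ultimately have "g \<otimes> b \<in> g <# B" "\<rho> (p \<otimes> y) \<le> \<rho> (p \<otimes> (g \<otimes> b))"
      using p g xG y by (auto simp: l_coset_def m_assoc)
    then show ?thesis by blast
  qed
  then show "y \<in> hull (g <# B)"
    using g xG y by (simp add: hull_def)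
qed

lemma l_coset_hull:
  assumes g: "g \<in> carrier G" and B: "B \<subseteq> carrier G"
  shows "g <# hull B = hull (g <# B)"
proof
  show "g <# hull B \<subseteq> hull (g <# B)" by (rule l_coset_hull_subset[OF g B])
  have gB: "g <# B \<subseteq> carrier G" by (rule l_coset_subset_G[OF B g])
  have H: "hull (g <# B) \<subseteq> carrier G" by (auto simp: hull_def)
  have "inv g <# hull (g <# B) \<subseteq> hull (inv g <# (g <# B))"
    using g gB by (intro l_coset_hull_subset) auto
  also have "inv g <# (g <# B) = B"
    using g B by (simp add: lcos_m_assoc lcos_mult_one)
  finally have "g <# (inv g <# hull (g <# B)) \<subseteq> g <# hull B"
    by (auto simp: l_coset_def)
  then show "hull (g <# B) \<subseteq> g <# hull B"
    using g H by (simp add: lcos_m_assoc lcos_mult_one)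
qed

lemma invariant_hull: "invariant G (hull ` Fpow (carrier G))"
proof -
  have "g <# hull B \<in> hull ` Fpow (carrier G)"
    if "B \<in> Fpow (carrier G)" "g \<in> carrier G" for g B
  proof -
    have B: "B \<subseteq> carrier G" "finite B" using that by (auto simp: Fpow_def)
    have "g <# B \<in> Fpow (carrier G)"
      using l_coset_subset_G[OF B(1) that(2)] B(2) by (auto simp: Fpow_def l_coset_def)
    then show ?thesis using l_coset_hull[OF that(2) B(1)] by blast
  qed
  then show ?thesis unfolding invariant_def by blast
qed

lemma midpointed_hull: "midpointed G hull"
proof -
  have "g \<in> hull {g \<otimes> h, g \<otimes> inv h}" if g: "g \<in> carrier G" and h: "h \<in> carrier G" for g h
  proof -
    have "\<rho> (p \<otimes> g) \<le> max (\<rho> (p \<otimes> (g \<otimes> h))) (\<rho> (p \<otimes> (g \<otimes> inv h)))"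
      if "p \<in> carrier G" for p
      using rank_midpoint[of "p \<otimes> g" h] that g h by (simp add: m_assoc)
    then show ?thesis using g by (auto simp: hull_def le_max_iff_disj)
  qed
  then show ?thesis unfolding midpointed_def by blast
qed

end

section \<open>Lengths of products in the free group\<close>

abbreviation inv_word :: "letter list \<Rightarrow> letter list" where
  "inv_word w \<equiv> rev (map inv_letter w)"

lemma inv_word_inv_word: "inv_word (inv_word w) = w"
  by (simp add: rev_map o_def)

lemma inv_letter_neq: "inv_letter x \<noteq> x"
  by (cases x) (simp add: inv_letter_def)

lemma reduced_append: "reduced (u @ v) \<Longrightarrow> reduced u \<and> reduced v"
  by (simp add: reduced_def successively_append_iff)

text \<open>
  Peeling off the outer letters of a self-inverse word leads to the centre, which is either a letter
  equal to its own inverse or a cancelling pair.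
\<close>

lemma self_inverse_reduced_word:
  assumes "reduced w" "inv_word w = w"
  shows "w = []"
  using assms
proof (induction w rule: length_induct)
  case (1 w)
  show ?case
  proof (cases w)
    case (Cons x v)
    show ?thesis
    proof (cases v rule: rev_cases)
      case Nil
      then show ?thesis using 1(3) Cons inv_letter_neq by simp
    next
      case (snoc m y)
      then have w: "w = x # m @ [y]" using Cons by simp
      have y: "y = inv_letter x" and m: "inv_word m = m" using 1(3) w by auto
      have "reduced m" using 1(2) w by (auto simp: reduced_Cons dest: reduced_append)
      then have "m = []" using 1(1) m w by simp
      then have False using 1(2) w y by (simp add: reduced_Cons)
      then show ?thesis ..
    qed
  qed simp
qed

text \<open>
  The prefix \<open>inv_word c\<close> and the suffix \<open>c\<close> each cover at least half of \<open>h\<close>. The middle part \<open>f\<close>, in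
  which they overlap, is therefore its own inverse, and so is \<open>h\<close>.
\<close>

lemma reduced_word_inverse_halves:
  assumes red: "reduced h" and pre: "h = inv_word c @ b" and suf: "h = e @ c"
    and len: "length b \<le> length c"
  shows "h = []"
proof -
  have "inv_word c @ b = e @ c" using pre suf by simp
  then obtain f where c: "c = f @ b"
    using len by (auto simp: append_eq_append_conv2)
  have "inv_word b @ inv_word f = e @ f"
    using pre suf c by simp
  moreover have "length (inv_word f) = length f" by simp
  ultimately have f: "inv_word f = f"
    by (metis append_eq_append_conv)
  have "h = inv_word b @ f @ b" using pre c f by simp
  then have "inv_word h = h" using f inv_word_inv_word[of b] by simp
  with red show ?thesis by (rule self_inverse_reduced_word)
qed

text \<open>The word \<open>c\<close> is the part of \<open>u\<close> that cancels against \<open>v\<close>.\<close>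

lemma foldr_push_cancel:
  assumes "reduced u"
  obtains a b c where "u = a @ c" "v = inv_word c @ b" "foldr push u v = a @ b"
proof -
  have "\<exists>a b c. u = a @ c \<and> v = inv_word c @ b \<and> foldr push u v = a @ b"
    using assms
  proof (induction u)
    case (Cons x u)
    then obtain a b c where IH: "u = a @ c" "v = inv_word c @ b" "foldr push u v = a @ b"
      by (auto simp: reduced_Cons)
    show ?case
    proof (cases "a = []")
      case False
      then have "push x (a @ b) = (x # a) @ b"
        using Cons.prems IH(1) by (cases a) (auto simp: reduced_Cons)
      then show ?thesis using IH by (metis append_Cons foldr_Cons comp_apply)
    next
      case a: True
      show ?thesis
      proof (cases "\<exists>b'. b = inv_letter x # b'")
        case True
        then obtain b' where "b = inv_letter x # b'" by blast
        then have "x # u = [] @ (x # c) \<and> v = inv_word (x # c) @ b'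
            \<and> foldr push (x # u) v = [] @ b'"
          using IH a by simp
        then show ?thesis by blast
      next
        case False
        then have "push x b = x # b" by (cases b) auto
        then have "x # u = [x] @ c \<and> v = inv_word c @ b \<and> foldr push (x # u) v = [x] @ b"
          using IH a by simp
        then show ?thesis using IH(2) by blast
      qed
    qed
  qed simp
  then show ?thesis using that by blast
qed

text \<open>
  The cancelled parts \<open>c\<close> of \<open>g h\<close> and \<open>c'\<close> of \<open>g h\<inverse>\<close> are both suffixes of \<open>g\<close>, so the shorter
  one is a suffix of the longer one. If neither product were longer than \<open>g\<close>, both would have at least half
  the length of \<open>h\<close>, and the shorter one would be a suffix of \<open>h\<close> whose inverse is a prefix of \<open>h\<close>.
\<close>

lemma length_less_max_mult:
  assumes g: "reduced g" and h: "reduced h" "h \<noteq> []"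
  shows "length g < max (length (foldr push g h)) (length (foldr push g (inv_word h)))"
proof (rule ccontr)
  assume "\<not> ?thesis"
  then have le: "length (foldr push g h) \<le> length g"
    "length (foldr push g (inv_word h)) \<le> length g" by auto
  obtain a b c where 1: "g = a @ c" "h = inv_word c @ b" "foldr push g h = a @ b"
    by (rule foldr_push_cancel[OF g])
  obtain a' b' c' where 2: "g = a' @ c'" "inv_word h = inv_word c' @ b'"
      "foldr push g (inv_word h) = a' @ b'"
    by (rule foldr_push_cancel[OF g])
  have b: "length b \<le> length c" using le(1) 1 by simp
  have b': "length b' \<le> length c'" using le(2) 2 by simp
  have h': "h = inv_word b' @ c'"
    using arg_cong[OF 2(2), of inv_word] by (simp add: rev_map o_def)
  from 1(1) 2(1) have "a @ c = a' @ c'" by simp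
  then obtain d where "c' = d @ c \<or> c = d @ c'"
    by (auto simp: append_eq_append_conv2)
  then show False
  proof
    assume "c' = d @ c"
    then have "h = (inv_word b' @ d) @ c" using h' by simp
    then show False
      using reduced_word_inverse_halves[OF h(1) 1(2) _ b] h(2) by blast
  next
    assume c: "c = d @ c'"
    have "h = inv_word c' @ (inv_word d @ b)" using 1(2) c by simp
    moreover have "length (inv_word d @ b) \<le> length c'"
      using arg_cong[OF h', of length] arg_cong[OF 1(2), of length] b' c by simp
    ultimately show False
      using reduced_word_inverse_halves[OF h(1) _ h'] h(2) by blast
  qed
qed

lemma inv_free_group:
  assumes "h \<in> carrier (free_group n)"
  shows "inv\<^bsub>free_group n\<^esub> h = inv_word h"
proof -
  interpret F: group "free_group n" by (rule group_free_group)
  have red: "reduced h" and "set h \<subseteq> UNIV \<times> {..<n}"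
    using assms by (auto simp: free_group_def)
  then have "inv_word h \<in> carrier (free_group n)"
    by (force simp: free_group_def reduced_rev_inv inv_letter_def)
  moreover have "inv_word h \<otimes>\<^bsub>free_group n\<^esub> h = \<one>\<^bsub>free_group n\<^esub>"
    using foldr_push_inverse[of "[]" h] red by (simp add: free_group_def foldr_push_Nil)
  ultimately show ?thesis
    using assms by (simp add: F.inv_equality)
qed

section \<open>The shortlex order on the free group\<close>

lemma length_less_imp_less: "length u < length v \<Longrightarrow> u < v"
  for u v :: "'a::linorder list"
  by (simp add: list_less_def lenlex_length lenlex_conv)

lemma ranked_group_free_group: "ranked_group (free_group n) (\<lambda>w. w)"
proof -
  interpret F: group "free_group n" by (rule group_free_group)
  show ?thesis
  proof unfold_locales
    fix b :: "letter list"
    have "{w \<in> carrier (free_group n). w \<le> b}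
        \<subseteq> {w. set w \<subseteq> UNIV \<times> {..<n} \<and> length w \<le> length b}"
      using length_less_imp_less[of b] by (auto simp: free_group_def not_le[symmetric])
    then show "finite {w \<in> carrier (free_group n). w \<le> b}"
      by (rule finite_subset) (simp add: finite_lists_length_le)
  next
    fix g h assume g: "g \<in> carrier (free_group n)" and h: "h \<in> carrier (free_group n)"
    show "g \<le> max (g \<otimes>\<^bsub>free_group n\<^esub> h) (g \<otimes>\<^bsub>free_group n\<^esub> inv\<^bsub>free_group n\<^esub> h)"
    proof (cases "h = []")
      case True
      then have "g \<otimes>\<^bsub>free_group n\<^esub> h = g"
        using g by (simp add: free_group_def foldr_push_Nil)
      then show ?thesis by simp
    next
      case False
      then have "length g < max (length (foldr push g h)) (length (foldr push g (inv_word h)))"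
        using g h by (intro length_less_max_mult) (auto simp: free_group_def)
      then have "g < foldr push g h \<or> g < foldr push g (inv_word h)"
        by (auto simp: less_max_iff_disj dest: length_less_imp_less)
      then show ?thesis
        using inv_free_group[OF h] by (auto simp: free_group_def le_max_iff_disj)
    qed
  qed simp
qed

theorem theorem45:
  fixes n :: nat
  shows "\<exists>\<C> \<tau>. convex_geometry (free_group n) \<C> \<tau> \<and>
                invariant (free_group n) \<C> \<and>
                midpointed (free_group n) \<tau>"
proof -
  interpret ranked_group "free_group n" "\<lambda>w. w"
    by (rule ranked_group_free_group)
  show ?thesis
    using convex_geometry_hull invariant_hull midpointed_hull by blast
qed

end
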